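(* Let $L$ be a countable first-order language, $n\ge1$, let $T$ be an $n$-consistent theory in $L$ such that $\alpha_n(T)\le\aleph_0$, and let $\mathcal M$ be an $n$-generated model of $T$. Then for every (finite) generating tuple $\bar a$ of $\mathcal M$ there exists an $L$-formula $\phi(\bar x)$ such that for every generating tuple $\bar b$ of $\mathcal M$ (of the same length as $\bar a$), $(\mathcal M,\bar a)\cong(\mathcal M,\bar b)$ if and only if $\mathcal M\models\phi(\bar b)$.
   Context: A theory in $L$ is a set of $L$-sentences. A tuple $\bar a$ generates $\mathcal M$ if every element of $\mathcal M$ equals $\tau(\bar a)$ for some $L$-term $\tau(\bar x)$; $\mathcal M$ is $n$-generated if it is generated by some $n$-tuple. $T$ is $n$-consistent if it has an $n$-generated model. $\alpha_n(T)$ is the number of $n$-generated models of $T$ up to isomorphism. $(\mathcal M,\bar a)\cong(\mathcal M,\bar b)$ means there is an automorphism of $\mathcal M$ sending $\bar a$ to $\bar b$. *)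

theory Defs
  imports "HOL-Library.Countable" "HOL-Library.Countable_Set"
begin

section \<open>First-order languages, terms and formulas\<close>

text \<open>The symbols of a language are subsets of the symbol types, so that a language may well
  have no function symbols or no relation symbols. Constants are nullary function symbols.\<close>

record ('f, 'r) lang =
  Funs :: "'f set"
  Rels :: "'r set"
  farity :: "'f \<Rightarrow> nat"
  rarity :: "'r \<Rightarrow> nat"

definition countable_lang :: "('f, 'r) lang \<Rightarrow> bool" where
  "countable_lang L \<longleftrightarrow> countable (Funs L) \<and> countable (Rels L)"

datatype 'f trm = Var nat | Fn 'f "'f trm list"

datatype ('f, 'r) form =
    Eq "'f trm" "'f trm"
  | Rel 'r "'f trm list"
  | Neg "('f, 'r) form"
  | Conj "('f, 'r) form" "('f, 'r) form"
  | Ex nat "('f, 'r) form"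

fun is_term :: "('f, 'r) lang \<Rightarrow> 'f trm \<Rightarrow> bool" where
  "is_term L (Var i) \<longleftrightarrow> True"
| "is_term L (Fn f ts) \<longleftrightarrow> f \<in> Funs L \<and> length ts = farity L f \<and> (\<forall>t \<in> set ts. is_term L t)"

fun is_formula :: "('f, 'r) lang \<Rightarrow> ('f, 'r) form \<Rightarrow> bool" where
  "is_formula L (Eq s t) \<longleftrightarrow> is_term L s \<and> is_term L t"
| "is_formula L (Rel r ts) \<longleftrightarrow> r \<in> Rels L \<and> length ts = rarity L r \<and> (\<forall>t \<in> set ts. is_term L t)"
| "is_formula L (Neg p) \<longleftrightarrow> is_formula L p"
| "is_formula L (Conj p q) \<longleftrightarrow> is_formula L p \<and> is_formula L q"
| "is_formula L (Ex i p) \<longleftrightarrow> is_formula L p"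

fun vars :: "'f trm \<Rightarrow> nat set" where
  "vars (Var i) = {i}"
| "vars (Fn f ts) = (\<Union>t \<in> set ts. vars t)"

fun free_vars :: "('f, 'r) form \<Rightarrow> nat set" where
  "free_vars (Eq s t) = vars s \<union> vars t"
| "free_vars (Rel r ts) = (\<Union>t \<in> set ts. vars t)"
| "free_vars (Neg p) = free_vars p"
| "free_vars (Conj p q) = free_vars p \<union> free_vars q"
| "free_vars (Ex i p) = free_vars p - {i}"

definition is_theory :: "('f, 'r) lang \<Rightarrow> ('f, 'r) form set \<Rightarrow> bool" where
  "is_theory L T \<longleftrightarrow> (\<forall>p \<in> T. is_formula L p \<and> free_vars p = {})"


section \<open>Structures, satisfaction and isomorphism\<close>

text \<open>The interpretations are total functions in HOL; only their values at symbols of the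
  language and at tuples of the right length from the universe matter.\<close>

record ('a, 'f, 'r) struc =
  universe :: "'a set"
  fint :: "'f \<Rightarrow> 'a list \<Rightarrow> 'a"
  rint :: "'r \<Rightarrow> 'a list \<Rightarrow> bool"

definition is_struc :: "('f, 'r) lang \<Rightarrow> ('a, 'f, 'r) struc \<Rightarrow> bool" where
  "is_struc L M \<longleftrightarrow> universe M \<noteq> {} \<and>
     (\<forall>f \<in> Funs L. \<forall>xs. length xs = farity L f \<and> set xs \<subseteq> universe M \<longrightarrow> fint M f xs \<in> universe M)"

fun eval :: "('a, 'f, 'r) struc \<Rightarrow> (nat \<Rightarrow> 'a) \<Rightarrow> 'f trm \<Rightarrow> 'a" where
  "eval M v (Var i) = v i"
| "eval M v (Fn f ts) = fint M f (map (eval M v) ts)"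

fun sat :: "('a, 'f, 'r) struc \<Rightarrow> (nat \<Rightarrow> 'a) \<Rightarrow> ('f, 'r) form \<Rightarrow> bool" where
  "sat M v (Eq s t) \<longleftrightarrow> eval M v s = eval M v t"
| "sat M v (Rel r ts) \<longleftrightarrow> rint M r (map (eval M v) ts)"
| "sat M v (Neg p) \<longleftrightarrow> \<not> sat M v p"
| "sat M v (Conj p q) \<longleftrightarrow> sat M v p \<and> sat M v q"
| "sat M v (Ex i p) \<longleftrightarrow> (\<exists>x \<in> universe M. sat M (v(i := x)) p)"

definition is_model :: "('f, 'r) lang \<Rightarrow> ('f, 'r) form set \<Rightarrow> ('a, 'f, 'r) struc \<Rightarrow> bool" where
  "is_model L T M \<longleftrightarrow> is_struc L M \<and>
     (\<forall>p \<in> T. \<forall>v. range v \<subseteq> universe M \<longrightarrow> sat M v p)"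

definition is_iso ::
  "('f, 'r) lang \<Rightarrow> ('a, 'f, 'r) struc \<Rightarrow> ('b, 'f, 'r) struc \<Rightarrow> ('a \<Rightarrow> 'b) \<Rightarrow> bool" where
  "is_iso L M N h \<longleftrightarrow> bij_betw h (universe M) (universe N) \<and>
     (\<forall>f \<in> Funs L. \<forall>xs. length xs = farity L f \<and> set xs \<subseteq> universe M \<longrightarrow>
        h (fint M f xs) = fint N f (map h xs)) \<and>
     (\<forall>r \<in> Rels L. \<forall>xs. length xs = rarity L r \<and> set xs \<subseteq> universe M \<longrightarrow>
        (rint M r xs \<longleftrightarrow> rint N r (map h xs)))"

definition isomorphic ::
  "('f, 'r) lang \<Rightarrow> ('a, 'f, 'r) struc \<Rightarrow> ('b, 'f, 'r) struc \<Rightarrow> bool" where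
  "isomorphic L M N \<longleftrightarrow> (\<exists>h. is_iso L M N h)"

definition aut_equiv :: "('f, 'r) lang \<Rightarrow> ('a, 'f, 'r) struc \<Rightarrow> 'a list \<Rightarrow> 'a list \<Rightarrow> bool" where
  "aut_equiv L M a b \<longleftrightarrow> (\<exists>h. is_iso L M M h \<and> map h a = b)"


section \<open>Finitely generated structures\<close>

text \<open>Tuples are lists. A term or formula in the variables of a tuple \<open>a\<close> has its (free) variables
  among the indices below \<open>length a\<close>, and is evaluated under the assignment \<open>(!) a\<close>, whose values
  beyond \<open>length a\<close> are then irrelevant.\<close>

definition generates :: "('f, 'r) lang \<Rightarrow> ('a, 'f, 'r) struc \<Rightarrow> 'a list \<Rightarrow> bool" where
  "generates L M a \<longleftrightarrow> set a \<subseteq> universe M \<and>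
     (\<forall>x \<in> universe M. \<exists>t. is_term L t \<and> vars t \<subseteq> {..<length a} \<and> x = eval M ((!) a) t)"

definition n_generated :: "('f, 'r) lang \<Rightarrow> nat \<Rightarrow> ('a, 'f, 'r) struc \<Rightarrow> bool" where
  "n_generated L n M \<longleftrightarrow> (\<exists>a. length a = n \<and> generates L M a)"

text \<open>HOL cannot quantify over structures on arbitrary carrier types inside a formula. An
  \<open>n\<close>-generated structure for a countable language is countable, so existence of such models and
  their number up to isomorphism are expressed by the models whose universe is a set of natural
  numbers; lemma \<open>n_gen_model_nat\<close> below shows that these represent all isomorphism types.\<close>

definition n_gen_models ::
  "('f, 'r) lang \<Rightarrow> nat \<Rightarrow> ('f, 'r) form set \<Rightarrow> (nat, 'f, 'r) struc set" where
  "n_gen_models L n T = {N. is_model L T N \<and> n_generated L n N}"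

definition n_consistent :: "('f, 'r) lang \<Rightarrow> nat \<Rightarrow> ('f, 'r) form set \<Rightarrow> bool" where
  "n_consistent L n T \<longleftrightarrow> n_gen_models L n T \<noteq> {}"

text \<open>The number of \<open>n\<close>-generated models up to isomorphism is the cardinality of the following set
  of isomorphism classes.\<close>

definition iso_classes ::
  "('f, 'r) lang \<Rightarrow> nat \<Rightarrow> ('f, 'r) form set \<Rightarrow> (nat, 'f, 'r) struc set set" where
  "iso_classes L n T = n_gen_models L n T //
     {(M, N). M \<in> n_gen_models L n T \<and> N \<in> n_gen_models L n T \<and> isomorphic L M N}"


section \<open>Every \<open>n\<close>-generated model is isomorphic to one on a set of natural numbers\<close>

instance trm :: (countable) countable
  by countable_datatype

lemma is_term_symbols: "is_term L t \<Longrightarrow> set_trm t \<subseteq> Funs L"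
  by (induction t) auto

lemma countable_terms:
  assumes "countable_lang L"
  shows "countable {t. is_term L t}"
proof -
  let ?g = "map_trm (to_nat_on (Funs L))"
  have inj: "inj_on (to_nat_on (Funs L)) (Funs L)"
    using assms by (simp add: countable_lang_def inj_on_to_nat_on)
  have "inj_on ?g {t. is_term L t}"
  proof (rule inj_onI)
    fix s t assume st: "s \<in> {t. is_term L t}" "t \<in> {t. is_term L t}" "?g s = ?g t"
    show "s = t"
    proof (rule trm.inj_map_strong[OF _ st(3)])
      fix x y assume "x \<in> set_trm s" "y \<in> set_trm t" "to_nat_on (Funs L) x = to_nat_on (Funs L) y"
      then show "x = y"
        using is_term_symbols[of L s] is_term_symbols[of L t] st inj by (auto dest: inj_onD)
    qed
  qed
  then show ?thesis
    by (rule countableI')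
qed

lemma countable_n_generated:
  assumes "countable_lang L" "n_generated L n M"
  shows "countable (universe M)"
proof -
  obtain a where "generates L M a"
    using assms by (auto simp: n_generated_def)
  then have "universe M \<subseteq> eval M ((!) a) ` {t. is_term L t}"
    by (fastforce simp: generates_def)
  then show ?thesis
    using countable_terms[OF assms(1)] by (meson countable_image countable_subset)
qed

lemma eval_in_univ:
  assumes "is_struc L M" "is_term L t" "\<And>i. i \<in> vars t \<Longrightarrow> v i \<in> universe M"
  shows "eval M v t \<in> universe M"
  using assms(2,3)
proof (induction t)
  case (Fn f ts)
  have "set (map (eval M v) ts) \<subseteq> universe M"
    using Fn by auto
  then show ?case
    using Fn.prems assms(1) by (simp add: is_struc_def)
qed auto

lemma iso_eval:
  assumes "is_struc L M" "is_iso L M N h"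
    and "is_term L t" "\<And>i. i \<in> vars t \<Longrightarrow> v i \<in> universe M" "\<And>i. i \<in> vars t \<Longrightarrow> w i = h (v i)"
  shows "eval N w t = h (eval M v t)"
  using assms(3-5)
proof (induction t)
  case (Fn f ts)
  have "\<forall>t \<in> set ts. eval M v t \<in> universe M"
    using Fn.prems by (auto intro!: eval_in_univ[OF assms(1)])
  then have "set (map (eval M v) ts) \<subseteq> universe M"
    by auto
  moreover have "map (eval N w) ts = map h (map (eval M v) ts)"
    using Fn by auto
  ultimately show ?case
    using Fn.prems assms(2) by (simp add: is_iso_def del: map_map)
qed auto

lemma iso_sat:
  assumes "is_struc L M" "is_iso L M N h"
    and "is_formula L p" "\<And>i. i \<in> free_vars p \<Longrightarrow> v i \<in> universe M"
      "\<And>i. i \<in> free_vars p \<Longrightarrow> w i = h (v i)"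
  shows "sat N w p \<longleftrightarrow> sat M v p"
  using assms(3-5)
proof (induction p arbitrary: v w)
  case (Eq s t)
  have e: "eval N w s = h (eval M v s)" "eval N w t = h (eval M v t)"
    using Eq by (auto intro!: iso_eval[OF assms(1,2)])
  have u: "eval M v s \<in> universe M" "eval M v t \<in> universe M"
    using Eq by (auto intro!: eval_in_univ[OF assms(1)])
  have "inj_on h (universe M)"
    using assms(2) by (simp add: is_iso_def bij_betw_def)
  with u e show ?case
    by (auto dest: inj_onD)
next
  case (Rel r ts)
  have "\<forall>t \<in> set ts. eval M v t \<in> universe M"
    using Rel.prems by (auto intro!: eval_in_univ[OF assms(1)])
  then have "set (map (eval M v) ts) \<subseteq> universe M"
    by auto
  moreover have "\<forall>t \<in> set ts. eval N w t = h (eval M v t)"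
    using Rel.prems by (auto intro!: iso_eval[OF assms(1,2)])
  then have "map (eval N w) ts = map h (map (eval M v) ts)"
    by auto
  ultimately show ?case
    using Rel.prems assms(2) by (simp add: is_iso_def del: map_map)
next
  case (Ex i p)
  have im: "universe N = h ` universe M"
    using assms(2) by (simp add: is_iso_def bij_betw_def)
  have "sat N (w(i := h x)) p \<longleftrightarrow> sat M (v(i := x)) p" if "x \<in> universe M" for x
    using Ex.prems that by (intro Ex.IH) auto
  then show ?case
    by (simp add: im)
next
  case (Neg p)
  have "sat N w p \<longleftrightarrow> sat M v p"
    using Neg.prems by (intro Neg.IH) auto
  then show ?case
    by simp
next
  case (Conj p q)
  have "sat N w p \<longleftrightarrow> sat M v p"
    using Conj.prems by (intro Conj.IH(1)) auto
  moreover have "sat N w q \<longleftrightarrow> sat M v q"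
    using Conj.prems by (intro Conj.IH(2)) auto
  ultimately show ?case
    by simp
qed

lemma n_gen_model_nat:
  fixes M :: "('a, 'f, 'r) struc"
  assumes "countable_lang L" "is_theory L T" "is_model L T M" "n_generated L n M"
  shows "\<exists>N \<in> n_gen_models L n T. isomorphic L M N"
proof -
  define h where "h = to_nat_on (universe M)"
  define g where "g = inv_into (universe M) h"
  have inj: "inj_on h (universe M)"
    using countable_n_generated[OF assms(1,4)] by (simp add: h_def inj_on_to_nat_on)
  have gh: "g (h x) = x" if "x \<in> universe M" for x
    using that inj by (simp add: g_def)
  have mgh: "map g (map h xs) = xs" if "set xs \<subseteq> universe M" for xs
    using that gh by (induction xs) auto
  define N :: "(nat, 'f, 'r) struc" where
    "N = \<lparr>universe = h ` universe M, fint = \<lambda>f ys. h (fint M f (map g ys)),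
          rint = \<lambda>r ys. rint M r (map g ys)\<rparr>"
  have struc: "is_struc L M"
    using assms(3) by (simp add: is_model_def)
  have iso: "is_iso L M N h"
    unfolding is_iso_def using inj mgh by (auto simp: N_def bij_betw_def simp del: map_map)
  have "is_struc L N"
    unfolding is_struc_def
  proof (intro conjI ballI allI impI)
    show "universe N \<noteq> {}"
      using struc by (simp add: N_def is_struc_def)
  next
    fix f ys assume f: "f \<in> Funs L" and ys: "length ys = farity L f \<and> set ys \<subseteq> universe N"
    have "set (map g ys) \<subseteq> universe M"
      using ys gh by (auto simp: N_def)
    then show "fint N f ys \<in> universe N"
      using struc f ys by (simp add: N_def is_struc_def)
  qed
  moreover have "sat N w p" if "p \<in> T" "range w \<subseteq> universe N" for p w
  proof -
    obtain x where x: "x \<in> universe M"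
      using struc by (auto simp: is_struc_def)
    have "sat N w p \<longleftrightarrow> sat M (\<lambda>_. x) p"
      using assms(2) that by (intro iso_sat[OF struc iso]) (auto simp: is_theory_def)
    then show ?thesis
      using assms(3) that x by (auto simp: is_model_def)
  qed
  ultimately have "is_model L T N"
    by (simp add: is_model_def)
  moreover have "n_generated L n N"
  proof -
    obtain a where a: "length a = n" "generates L M a"
      using assms(4) by (auto simp: n_generated_def)
    have "generates L N (map h a)"
      unfolding generates_def
    proof (intro conjI ballI)
      show "set (map h a) \<subseteq> universe N"
        using a(2) by (auto simp: generates_def N_def)
    next
      fix y assume "y \<in> universe N"
      then obtain x where x: "x \<in> universe M" "y = h x"
        by (auto simp: N_def)
      then obtain t where t: "is_term L t" "vars t \<subseteq> {..<length a}" "x = eval M ((!) a) t"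
        using a(2) by (auto simp: generates_def)
      have "eval N ((!) (map h a)) t = h (eval M ((!) a) t)"
        using t a(2) by (intro iso_eval[OF struc iso]) (auto simp: generates_def subset_eq)
      then show "\<exists>t. is_term L t \<and> vars t \<subseteq> {..<length (map h a)} \<and> y = eval N ((!) (map h a)) t"
        using t x by auto
    qed
    then show ?thesis
      using a(1) unfolding n_generated_def by (metis length_map)
  qed
  ultimately show ?thesis
    using iso by (auto simp: n_gen_models_def isomorphic_def)
qed

end

theory Submission
  imports Defs
begin

text \<open>The complete types of generating \<open>n\<close>-tuples of models of a theory form a G-delta set in the
  space of complete \<open>n\<close>-types: besides satisfying the theory, such a type must contain, with each
  existential formula, an instance of it at a term in the \<open>n\<close> variables, and these are countably
  many open conditions. The set is therefore a Polish space. It is countable when there are countably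
  many \<open>n\<close>-generated models, since each of them has countably many \<open>n\<close>-tuples. A countable Polish
  space has no nonempty subset without isolated points, so the set of types of the generating
  \<open>n\<close>-tuples of the given model has an isolated point: some formula singles out one generating
  \<open>n\<close>-tuple up to types, hence up to automorphisms (\<open>isolated_generating_tuple\<close>).

  The topological fact is proved here by the Baire category argument behind it. If no point is
  isolated, a decreasing sequence of nonempty definable sets of generating tuples of \<open>M\<close> can decide
  every formula, find a term as a witness for every existential formula, and in addition avoid the
  types of all \<open>n\<close>-tuples in countably many given structures (\<open>generic_sequence\<close>). Choosing a
  tuple from each set gives a sequence whose types converge. The limit type is realised by a
  generating tuple of a structure built from terms (locale \<open>complete_sequence\<close>), a model of the
  theory; if the given structures represent all \<open>n\<close>-generated models, it is isomorphic to none of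
  them, a contradiction.

  Finally, isolation passes from one generating tuple \<open>c\<close> to any other generating tuple \<open>a\<close>, even of
  a different length: each is the value of a tuple of terms at the other, so a formula for \<open>a\<close> can
  state that applying the terms for \<open>c\<close> gives a tuple satisfying the formula for \<open>c\<close> and that
  applying the terms for \<open>a\<close> to this tuple leads back (\<open>isolated_transfer\<close>).\<close>

section \<open>Countably many formulas\<close>

instance form :: (countable, countable) countable
  by countable_datatype

lemma is_formula_symbols:
  "is_formula L p \<Longrightarrow> set1_form p \<subseteq> Funs L \<and> set2_form p \<subseteq> Rels L"
  by (induction p) (auto dest!: is_term_symbols)

lemma countable_formulas:
  assumes "countable_lang L"
  shows "countable {p. is_formula L p}"
proof -
  let ?g = "map_form (to_nat_on (Funs L)) (to_nat_on (Rels L))"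
  have inj: "inj_on (to_nat_on (Funs L)) (Funs L)" "inj_on (to_nat_on (Rels L)) (Rels L)"
    using assms by (simp_all add: countable_lang_def inj_on_to_nat_on)
  have "inj_on ?g {p. is_formula L p}"
  proof (rule inj_onI)
    fix p q assume pq: "p \<in> {p. is_formula L p}" "q \<in> {p. is_formula L p}" "?g p = ?g q"
    have "set1_form p \<subseteq> Funs L" "set1_form q \<subseteq> Funs L" "set2_form p \<subseteq> Rels L" "set2_form q \<subseteq> Rels L"
      using is_formula_symbols pq by blast+
    then show "p = q"
      using inj by (intro form.inj_map_strong[OF _ _ pq(3)]) (auto dest: inj_onD)
  qed
  then show ?thesis
    by (rule countableI')
qed


section \<open>Substitution of terms in formulas\<close>

lemma eval_cong: "(\<And>i. i \<in> vars t \<Longrightarrow> v i = w i) \<Longrightarrow> eval M v t = eval M w t"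
proof (induction t)
  case (Var i)
  show ?case
    using Var[of i] by simp
next
  case (Fn f ts)
  have "eval M v t = eval M w t" if "t \<in> set ts" for t
    by (rule Fn.IH[OF that], rule Fn.prems) (use that in auto)
  then show ?case
    by (simp cong: map_cong)
qed

lemma sat_cong: "(\<And>i. i \<in> free_vars p \<Longrightarrow> v i = w i) \<Longrightarrow> sat M v p \<longleftrightarrow> sat M w p"
proof (induction p arbitrary: v w)
  case (Eq s t)
  have "eval M v s = eval M w s" "eval M v t = eval M w t"
    by (rule eval_cong, rule Eq, simp)+
  then show ?case
    by simp
next
  case (Rel r ts)
  have "eval M v t = eval M w t" if "t \<in> set ts" for t
    by (rule eval_cong, rule Rel) (use that in auto)
  then show ?case
    by (simp cong: map_cong)
next
  case (Neg p)
  have "sat M v p \<longleftrightarrow> sat M w p"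
    by (rule Neg.IH, rule Neg.prems) simp
  then show ?case by simp
next
  case (Conj p q)
  have "sat M v p \<longleftrightarrow> sat M w p"
    by (rule Conj.IH(1), rule Conj.prems) simp
  moreover have "sat M v q \<longleftrightarrow> sat M w q"
    by (rule Conj.IH(2), rule Conj.prems) simp
  ultimately show ?case by simp
next
  case (Ex i p)
  have "sat M (v(i := x)) p \<longleftrightarrow> sat M (w(i := x)) p" for x
    by (rule Ex.IH) (simp add: Ex.prems)
  then show ?case by simp
qed

lemma finite_vars: "finite (vars t)"
  by (induction t) auto

lemma finite_free_vars: "finite (free_vars p)"
  by (induction p) (auto simp: finite_vars)

fun subst_trm :: "(nat \<Rightarrow> 'f trm) \<Rightarrow> 'f trm \<Rightarrow> 'f trm" where
  "subst_trm s (Var i) = s i"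
| "subst_trm s (Fn f ts) = Fn f (map (subst_trm s) ts)"

lemma is_term_subst:
  "is_term L t \<Longrightarrow> (\<And>i. i \<in> vars t \<Longrightarrow> is_term L (s i)) \<Longrightarrow> is_term L (subst_trm s t)"
  by (induction t) auto

lemma vars_subst: "vars (subst_trm s t) = (\<Union>i \<in> vars t. vars (s i))"
  by (induction t) auto

lemma eval_subst: "eval M v (subst_trm s t) = eval M (\<lambda>i. eval M v (s i)) t"
  by (induction t) (auto simp: comp_def cong: map_cong)

definition fresh :: "(nat \<Rightarrow> 'f trm) \<Rightarrow> nat set \<Rightarrow> nat" where
  "fresh s A = (LEAST j. \<forall>m \<in> A. j \<notin> vars (s m))"

lemma fresh:
  assumes "finite A" "m \<in> A"
  shows "fresh s A \<notin> vars (s m)"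
proof -
  have "finite (\<Union>m \<in> A. vars (s m))"
    using assms by (simp add: finite_vars)
  then have "\<exists>j. \<forall>m \<in> A. j \<notin> vars (s m)"
    using ex_new_if_finite[OF infinite_UNIV_nat] by fastforce
  then have "\<forall>m \<in> A. fresh s A \<notin> vars (s m)"
    unfolding fresh_def by (rule LeastI_ex)
  then show ?thesis
    using assms(2) by blast
qed

text \<open>Terms substituted below a quantifier may contain the bound variable, so it is renamed to one
  that occurs in none of the terms that are actually substituted.\<close>

fun subst :: "(nat \<Rightarrow> 'f trm) \<Rightarrow> ('f, 'r) form \<Rightarrow> ('f, 'r) form" where
  "subst s (Eq t u) = Eq (subst_trm s t) (subst_trm s u)"
| "subst s (Rel r ts) = Rel r (map (subst_trm s) ts)"
| "subst s (Neg p) = Neg (subst s p)"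
| "subst s (Conj p q) = Conj (subst s p) (subst s q)"
| "subst s (Ex i p) =
    (let j = fresh s (free_vars p - {i}) in Ex j (subst (s(i := Var j)) p))"

lemma is_formula_subst:
  "is_formula L p \<Longrightarrow> (\<And>i. i \<in> free_vars p \<Longrightarrow> is_term L (s i)) \<Longrightarrow> is_formula L (subst s p)"
proof (induction p arbitrary: s)
  case (Ex i p)
  then show ?case by (auto simp: Let_def)
qed (auto intro!: is_term_subst)

lemma free_vars_subst: "free_vars (subst s p) \<subseteq> (\<Union>i \<in> free_vars p. vars (s i))"
proof (induction p arbitrary: s)
  case (Conj p q)
  have "free_vars (subst s p) \<subseteq> (\<Union>i \<in> free_vars p. vars (s i))"
    "free_vars (subst s q) \<subseteq> (\<Union>i \<in> free_vars q. vars (s i))"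
    by (fact Conj.IH)+
  then show ?case
    by (simp only: subst.simps free_vars.simps UN_Un) blast
next
  case (Ex i p)
  let ?j = "fresh s (free_vars p - {i})"
  show ?case
  proof
    fix k assume "k \<in> free_vars (subst s (Ex i p))"
    then have k: "k \<in> free_vars (subst (s(i := Var ?j)) p)" "k \<noteq> ?j"
      by (simp_all add: Let_def)
    then obtain m where m: "m \<in> free_vars p" "k \<in> vars ((s(i := Var ?j)) m)"
      using subsetD[OF Ex.IH k(1)] by blast
    then have "m \<noteq> i" "k \<in> vars (s m)"
      using k(2) by (cases "m = i"; simp)+
    with m(1) show "k \<in> (\<Union>m \<in> free_vars (Ex i p). vars (s m))"
      by auto
  qed
qed (simp_all add: vars_subst)

text \<open>Capture avoidance, semantically: moving a quantified value to the fresh variable does not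
  disturb the terms substituted for the other free variables.\<close>

lemma sat_upd_fresh:
  fixes s i p
  defines "j \<equiv> fresh s (free_vars p - {i})"
  shows "sat M (\<lambda>m. eval M (v(j := x)) ((s(i := Var j)) m)) p
    \<longleftrightarrow> sat M ((\<lambda>m. eval M v (s m))(i := x)) p"
proof (rule sat_cong)
  fix m assume m: "m \<in> free_vars p"
  show "eval M (v(j := x)) ((s(i := Var j)) m) = ((\<lambda>m. eval M v (s m))(i := x)) m"
  proof (cases "m = i")
    case False
    then have "j \<notin> vars (s m)"
      using m unfolding j_def by (intro fresh) (auto simp: finite_free_vars)
    then have "eval M (v(j := x)) (s m) = eval M v (s m)"
      by (intro eval_cong) auto
    then show ?thesis
      using False by simp
  qed simp
qed

lemma sat_subst: "sat M v (subst s p) \<longleftrightarrow> sat M (\<lambda>i. eval M v (s i)) p"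
proof (induction p arbitrary: v s)
  case (Eq t u)
  then show ?case by (simp add: eval_subst)
next
  case (Rel r ts)
  then show ?case by (simp add: comp_def eval_subst)
next
  case (Ex i p)
  let ?j = "fresh s (free_vars p - {i})"
  have "sat M (v(?j := x)) (subst (s(i := Var ?j)) p)
      \<longleftrightarrow> sat M ((\<lambda>m. eval M v (s m))(i := x)) p" for x
    unfolding Ex.IH by (rule sat_upd_fresh)
  then show ?case
    by (simp only: subst.simps Let_def sat.simps)
qed simp_all

text \<open>This hides the choice of the bound variable: the matrix of a substituted existential formula
  is used below only through its meaning.\<close>

lemma subst_Ex:
  "\<exists>j q. subst s (Ex i p) = Ex j q \<and>
    (\<forall>v x. sat M (v(j := x)) q \<longleftrightarrow> sat M ((\<lambda>m. eval M v (s m))(i := x)) p)"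
proof (intro exI conjI allI)
  let ?j = "fresh s (free_vars p - {i})"
  show "subst s (Ex i p) = Ex ?j (subst (s(i := Var ?j)) p)"
    by (simp only: subst.simps Let_def)
  show "sat M (v(?j := x)) (subst (s(i := Var ?j)) p)
      \<longleftrightarrow> sat M ((\<lambda>m. eval M v (s m))(i := x)) p" for v x
    unfolding sat_subst by (rule sat_upd_fresh)
qed


section \<open>Generating tuples\<close>

definition trms :: "('f, 'r) lang \<Rightarrow> nat \<Rightarrow> 'f trm set" where
  "trms L n = {t. is_term L t \<and> vars t \<subseteq> {..<n}}"

definition fmls :: "('f, 'r) lang \<Rightarrow> nat \<Rightarrow> ('f, 'r) form set" where
  "fmls L n = {p. is_formula L p \<and> free_vars p \<subseteq> {..<n}}"

definition gens :: "('f, 'r) lang \<Rightarrow> ('a, 'f, 'r) struc \<Rightarrow> nat \<Rightarrow> 'a list set" where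
  "gens L M n = {c. length c = n \<and> generates L M c}"

lemma subst_in_fmls:
  assumes "is_formula L p" "\<And>i. i \<in> free_vars p \<Longrightarrow> s i \<in> trms L n"
  shows "subst s p \<in> fmls L n"
  using assms free_vars_subst[of s p] is_formula_subst[of L p s] 
  by (fastforce simp: trms_def fmls_def)

lemma subst_trm_in_trms:
  assumes "is_term L t" "\<And>i. i \<in> vars t \<Longrightarrow> s i \<in> trms L n"
  shows "subst_trm s t \<in> trms L n"
  using assms is_term_subst[of L t s] by (fastforce simp: trms_def vars_subst)

lemma gens_nth:
  assumes "c \<in> gens L M n" "i < n"
  shows "c ! i \<in> universe M"
  using assms by (auto simp: gens_def generates_def subset_eq)

lemma gens_eval_in:
  assumes "is_struc L M" "c \<in> gens L M n" "t \<in> trms L n"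
  shows "eval M ((!) c) t \<in> universe M"
  using assms gens_nth[OF assms(2)] by (intro eval_in_univ[OF assms(1)]) (auto simp: trms_def)

lemma gens_term:
  assumes "c \<in> gens L M n" "x \<in> universe M"
  obtains t where "t \<in> trms L n" "x = eval M ((!) c) t"
  using assms unfolding gens_def generates_def trms_def by auto

lemma gens_terms:
  assumes "c \<in> gens L M n" "set xs \<subseteq> universe M"
  obtains ts where "set ts \<subseteq> trms L n" "xs = map (eval M ((!) c)) ts"
proof -
  have "\<exists>ts. set ts \<subseteq> trms L n \<and> xs = map (eval M ((!) c)) ts"
    using assms(2)
  proof (induction xs)
    case (Cons x xs)
    then obtain ts where "set ts \<subseteq> trms L n" "xs = map (eval M ((!) c)) ts"
      by auto
    moreover obtain t where "t \<in> trms L n" "x = eval M ((!) c) t"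
      using gens_term[OF assms(1), of x] Cons.prems by auto
    ultimately show ?case
      by (intro exI[of _ "t # ts"]) auto
  qed auto
  then show ?thesis
    using that by auto
qed

text \<open>Every element is a term in the generators, so \<open>\<tau>(c) \<mapsto> \<tau>(d)\<close> is the only candidate for an
  automorphism; agreement of \<open>c\<close> and \<open>d\<close> on atomic formulas makes it well defined and an
  isomorphism.\<close>

lemma same_type_aut_equiv:
  assumes M: "is_struc L M" and c: "c \<in> gens L M n" and d: "d \<in> gens L M n"
    and type: "\<And>\<phi>. \<phi> \<in> fmls L n \<Longrightarrow> sat M ((!) c) \<phi> \<longleftrightarrow> sat M ((!) d) \<phi>"
  shows "aut_equiv L M c d"
proof -
  let ?C = "eval M ((!) c)" and ?D = "eval M ((!) d)"
  define h where "h x = ?D (SOME t. t \<in> trms L n \<and> x = ?C t)" for x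
  have eq: "?C s = ?C t \<longleftrightarrow> ?D s = ?D t" if "s \<in> trms L n" "t \<in> trms L n" for s t
    using type[of "Eq s t"] that by (auto simp: trms_def fmls_def)
  have h: "h (?C t) = ?D t" if "t \<in> trms L n" for t
  proof -
    have "(SOME s. s \<in> trms L n \<and> ?C t = ?C s) \<in> trms L n \<and> ?C t = ?C (SOME s. s \<in> trms L n \<and> ?C t = ?C s)"
      by (rule someI[of _ t]) (use that in auto)
    then show ?thesis
      using eq that unfolding h_def by auto
  qed
  have hs: "map h (map ?C ts) = map ?D ts" if "set ts \<subseteq> trms L n" for ts
    using that h by auto
  have "is_iso L M M h"
    unfolding is_iso_def bij_betw_def
  proof (intro conjI ballI allI impI)
    show "inj_on h (universe M)"
      by (rule inj_onI) (metis eq gens_term[OF c] h)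
    show "h ` universe M = universe M"
    proof
      show "h ` universe M \<subseteq> universe M"
        using gens_eval_in[OF M d] h gens_term[OF c] by (metis image_subsetI)
      show "universe M \<subseteq> h ` universe M"
        using gens_eval_in[OF M c] h gens_term[OF d] by (metis image_eqI subsetI)
    qed
  next
    fix f xs assume f: "f \<in> Funs L" and xs: "length xs = farity L f \<and> set xs \<subseteq> universe M"
    obtain ts where ts: "set ts \<subseteq> trms L n" "xs = map ?C ts"
      using gens_terms[OF c] xs by blast
    then have "Fn f ts \<in> trms L n"
      using f xs by (auto simp: trms_def)
    then show "h (fint M f xs) = fint M f (map h xs)"
      using h[of "Fn f ts"] ts hs by (simp del: map_map)
  next
    fix r xs assume r: "r \<in> Rels L" and xs: "length xs = rarity L r \<and> set xs \<subseteq> universe M"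
    obtain ts where ts: "set ts \<subseteq> trms L n" "xs = map ?C ts"
      using gens_terms[OF c] xs by blast
    then have "Rel r ts \<in> fmls L n"
      using r xs by (auto simp: trms_def fmls_def)
    then show "rint M r xs \<longleftrightarrow> rint M r (map h xs)"
      using type[of "Rel r ts"] ts hs by (simp del: map_map)
  qed
  moreover have "map h c = d"
  proof (rule nth_equalityI)
    show "length (map h c) = length d"
      using c d by (simp add: gens_def)
    fix i assume "i < length (map h c)"
    then show "map h c ! i = d ! i"
      using h[of "Var i"] c by (simp add: gens_def trms_def)
  qed
  ultimately show ?thesis
    by (auto simp: aut_equiv_def)
qed


section \<open>Limits of sequences of generating tuples\<close>

text \<open>Truth of every formula along the sequence is eventually constant, that is, the types of the
  tuples converge in the space of complete types; the last assumption says that existential formulas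
  in the limit type have terms as witnesses. Formulas are evaluated at terms in the \<open>n\<close> generators
  instead of being substituted into, which is the form needed for an induction on formulas.\<close>

locale complete_sequence =
  fixes L :: "('f, 'r) lang" and M :: "('a, 'f, 'r) struc" and n :: nat and c :: "nat \<Rightarrow> 'a list"
  assumes struc: "is_struc L M"
    and gens: "c k \<in> gens L M n"
    and decided: "\<lbrakk>is_formula L p; range s \<subseteq> trms L n\<rbrakk> \<Longrightarrow>
      (\<forall>\<^sub>F k in sequentially. sat M (\<lambda>i. eval M ((!) (c k)) (s i)) p) \<or>
      (\<forall>\<^sub>F k in sequentially. \<not> sat M (\<lambda>i. eval M ((!) (c k)) (s i)) p)"
    and witnessed: "\<lbrakk>is_formula L p; range s \<subseteq> trms L n;
        \<forall>\<^sub>F k in sequentially. sat M (\<lambda>i. eval M ((!) (c k)) (s i)) (Ex i p)\<rbrakk> \<Longrightarrow>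
      \<exists>t \<in> trms L n. \<forall>\<^sub>F k in sequentially.
        sat M ((\<lambda>i. eval M ((!) (c k)) (s i))(i := eval M ((!) (c k)) t)) p"
begin

abbreviation ev :: "nat \<Rightarrow> 'f trm \<Rightarrow> 'a" where
  "ev k \<equiv> eval M ((!) (c k))"

text \<open>The limit structure consists of terms up to eventual equality along the sequence. A chosen
  term stands for each class, so that equality in the structure is equality of terms and no quotient
  is needed.\<close>

definition rep :: "'f trm \<Rightarrow> 'f trm" where
  "rep t = (SOME s. s \<in> trms L n \<and> (\<forall>\<^sub>F k in sequentially. ev k s = ev k t))"

definition lim :: "('f trm, 'f, 'r) struc" where
  "lim = \<lparr>universe = rep ` trms L n, fint = \<lambda>f ts. rep (Fn f ts),
    rint = \<lambda>r ts. \<forall>\<^sub>F k in sequentially. rint M r (map (ev k) ts)\<rparr>"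

lemma rep:
  assumes "t \<in> trms L n"
  shows "rep t \<in> trms L n" "\<forall>\<^sub>F k in sequentially. ev k (rep t) = ev k t"
proof -
  have "rep t \<in> trms L n \<and> (\<forall>\<^sub>F k in sequentially. ev k (rep t) = ev k t)"
    unfolding rep_def by (rule someI[of _ t]) (use assms in auto)
  then show "rep t \<in> trms L n" "\<forall>\<^sub>F k in sequentially. ev k (rep t) = ev k t"
    by auto
qed

lemma lim_eqI:
  assumes "s \<in> universe lim" "t \<in> universe lim" "\<forall>\<^sub>F k in sequentially. ev k s = ev k t"
  shows "s = t"
proof -
  obtain s' t' where st: "s' \<in> trms L n" "s = rep s'" "t' \<in> trms L n" "t = rep t'"
    using assms by (auto simp: lim_def)
  have "\<forall>\<^sub>F k in sequentially. ev k s' = ev k t'"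
    using assms(3) rep(2)[OF st(1)] rep(2)[OF st(3)] unfolding st(2,4)
    by eventually_elim simp
  then have "(\<forall>\<^sub>F k in sequentially. ev k u = ev k s') \<longleftrightarrow> (\<forall>\<^sub>F k in sequentially. ev k u = ev k t')" for u
    by (intro eventually_cong) (auto elim: eventually_mono)
  then show ?thesis
    unfolding st rep_def by simp
qed

lemma lim_trms: "universe lim \<subseteq> trms L n"
  using rep(1) by (auto simp: lim_def)

lemma rint_lim: "rint lim r ts \<longleftrightarrow> (\<forall>\<^sub>F k in sequentially. rint M r (map (ev k) ts))"
  by (simp add: lim_def)

lemma is_struc_lim: "is_struc L lim"
  unfolding is_struc_def
proof (intro conjI ballI allI impI)
  obtain x where "x \<in> universe M"
    using struc by (auto simp: is_struc_def)
  then obtain t where "t \<in> trms L n"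
    using gens_term[OF gens] by metis
  then show "universe lim \<noteq> {}"
    by (auto simp: lim_def)
next
  fix f xs assume "f \<in> Funs L" "length xs = farity L f \<and> set xs \<subseteq> universe lim"
  then have "Fn f xs \<in> trms L n"
    using lim_trms by (auto simp: trms_def)
  then show "fint lim f xs \<in> universe lim"
    by (auto simp: lim_def)
qed

lemma eval_lim:
  assumes "is_term L t" "\<And>i. i \<in> vars t \<Longrightarrow> v i \<in> universe lim"
  shows "\<forall>\<^sub>F k in sequentially. ev k (eval lim v t) = eval M (\<lambda>i. ev k (v i)) t"
  using assms
proof (induction t)
  case (Fn f ts)
  let ?u = "Fn f (map (eval lim v) ts)"
  have "set (map (eval lim v) ts) \<subseteq> trms L n"
    using Fn.prems lim_trms eval_in_univ[OF is_struc_lim] by fastforce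
  then have "?u \<in> trms L n"
    using Fn.prems by (auto simp: trms_def)
  then have 1: "\<forall>\<^sub>F k in sequentially. ev k (eval lim v (Fn f ts)) = ev k ?u"
    using rep(2)[of ?u] by (simp add: lim_def)
  have "\<forall>t \<in> set ts. \<forall>\<^sub>F k in sequentially. ev k (eval lim v t) = eval M (\<lambda>i. ev k (v i)) t"
    using Fn by auto
  then have "\<forall>\<^sub>F k in sequentially. \<forall>t \<in> set ts. ev k (eval lim v t) = eval M (\<lambda>i. ev k (v i)) t"
    by (intro eventually_ball_finite) auto
  then have "\<forall>\<^sub>F k in sequentially. ev k ?u = eval M (\<lambda>i. ev k (v i)) (Fn f ts)"
  proof eventually_elim
    case (elim k)
    then show ?case by (simp add: comp_def cong: map_cong)
  qed
  with 1 show ?case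
    by eventually_elim simp
qed auto

text \<open>The limit structure satisfies exactly what holds eventually. As with the fundamental theorem
  on ultraproducts, negation uses that each formula is decided; the quantifier uses the witnesses.\<close>

lemma sat_lim:
  assumes "is_formula L p" "range v \<subseteq> universe lim"
  shows "sat lim v p \<longleftrightarrow> (\<forall>\<^sub>F k in sequentially. sat M (\<lambda>i. ev k (v i)) p)"
  using assms
proof (induction p arbitrary: v)
  case (Eq s t)
  have e: "\<forall>\<^sub>F k in sequentially. ev k (eval lim v s) = eval M (\<lambda>i. ev k (v i)) s"
    "\<forall>\<^sub>F k in sequentially. ev k (eval lim v t) = eval M (\<lambda>i. ev k (v i)) t"
    using Eq by (auto intro!: eval_lim)
  have u: "eval lim v s \<in> universe lim" "eval lim v t \<in> universe lim"
    using Eq by (auto intro!: eval_in_univ[OF is_struc_lim])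
  show ?case
  proof
    assume "sat lim v (Eq s t)"
    then have eq: "eval lim v s = eval lim v t"
      by simp
    show "\<forall>\<^sub>F k in sequentially. sat M (\<lambda>i. ev k (v i)) (Eq s t)"
      using e by eventually_elim (simp add: eq)
  next
    assume "\<forall>\<^sub>F k in sequentially. sat M (\<lambda>i. ev k (v i)) (Eq s t)"
    then have "\<forall>\<^sub>F k in sequentially. ev k (eval lim v s) = ev k (eval lim v t)"
      using e by eventually_elim simp
    then show "sat lim v (Eq s t)"
      using lim_eqI[OF u] by simp
  qed
next
  case (Rel r ts)
  have "\<forall>t \<in> set ts. \<forall>\<^sub>F k in sequentially. ev k (eval lim v t) = eval M (\<lambda>i. ev k (v i)) t"
    using Rel by (auto intro!: eval_lim)
  then have "\<forall>\<^sub>F k in sequentially. \<forall>t \<in> set ts. ev k (eval lim v t) = eval M (\<lambda>i. ev k (v i)) t"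
    by (intro eventually_ball_finite) auto
  then have "\<forall>\<^sub>F k in sequentially.
      rint M r (map (ev k) (map (eval lim v) ts)) \<longleftrightarrow> sat M (\<lambda>i. ev k (v i)) (Rel r ts)"
  proof eventually_elim
    case (elim k)
    then show ?case by (simp add: comp_def cong: map_cong)
  qed
  then have "(\<forall>\<^sub>F k in sequentially. rint M r (map (ev k) (map (eval lim v) ts))) \<longleftrightarrow>
      (\<forall>\<^sub>F k in sequentially. sat M (\<lambda>i. ev k (v i)) (Rel r ts))"
    by (rule eventually_cong)
  then show ?case
    by (simp only: sat.simps rint_lim)
next
  case (Neg p)
  have "sat lim v p \<longleftrightarrow> (\<forall>\<^sub>F k in sequentially. sat M (\<lambda>i. ev k (v i)) p)"
    using Neg by simp
  moreover have "(\<forall>\<^sub>F k in sequentially. sat M (\<lambda>i. ev k (v i)) p) \<or>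
      (\<forall>\<^sub>F k in sequentially. \<not> sat M (\<lambda>i. ev k (v i)) p)"
    using Neg.prems lim_trms by (intro decided) auto
  moreover have False if "\<forall>\<^sub>F k in sequentially. sat M (\<lambda>i. ev k (v i)) p"
      "\<forall>\<^sub>F k in sequentially. \<not> sat M (\<lambda>i. ev k (v i)) p"
    using eventually_happens[OF eventually_conj[OF that]] by auto
  ultimately show ?case
    by auto
next
  case (Conj p q)
  then show ?case
    by (simp add: eventually_conj_iff)
next
  case (Ex i p)
  have IH: "sat lim (v(i := t)) p \<longleftrightarrow> (\<forall>\<^sub>F k in sequentially. sat M ((\<lambda>m. ev k (v m))(i := ev k t)) p)"
    if "t \<in> universe lim" for t
  proof -
    have "sat lim (v(i := t)) p \<longleftrightarrow> (\<forall>\<^sub>F k in sequentially. sat M (\<lambda>m. ev k ((v(i := t)) m)) p)"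
      using Ex.prems that by (intro Ex.IH) auto
    moreover have "(\<lambda>m. ev k ((v(i := t)) m)) = (\<lambda>m. ev k (v m))(i := ev k t)" for k
      by auto
    ultimately show ?thesis by simp
  qed
  show ?case
  proof
    assume "sat lim v (Ex i p)"
    then obtain t where t: "t \<in> universe lim" "sat lim (v(i := t)) p"
      by auto
    then have "ev k t \<in> universe M" for k
      using lim_trms gens_eval_in[OF struc gens] by blast
    then show "\<forall>\<^sub>F k in sequentially. sat M (\<lambda>i. ev k (v i)) (Ex i p)"
      using t IH[OF t(1)] by (auto elim!: eventually_mono)
  next
    assume "\<forall>\<^sub>F k in sequentially. sat M (\<lambda>i. ev k (v i)) (Ex i p)"
    then obtain t where t: "t \<in> trms L n" 
        "\<forall>\<^sub>F k in sequentially. sat M ((\<lambda>m. ev k (v m))(i := ev k t)) p"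
      using witnessed[of p v i] Ex.prems lim_trms by auto
    have "\<forall>\<^sub>F k in sequentially. sat M ((\<lambda>m. ev k (v m))(i := ev k (rep t))) p"
      using t(2) rep(2)[OF t(1)] by eventually_elim simp
    then show "sat lim v (Ex i p)"
      using IH[of "rep t"] t(1) by (auto simp: lim_def)
  qed
qed

definition lim_tuple :: "'f trm list" where
  "lim_tuple = map (\<lambda>i. rep (Var i)) [0..<n]"

lemma lim_tuple_nth:
  assumes "i < n"
  shows "lim_tuple ! i \<in> universe lim" "\<forall>\<^sub>F k in sequentially. ev k (lim_tuple ! i) = c k ! i"
  using assms rep(2)[of "Var i"] by (auto simp: lim_tuple_def trms_def lim_def)

lemma lim_tuple_gens: "lim_tuple \<in> gens L lim n"
proof -
  have "t = eval lim ((!) lim_tuple) t" if t: "t \<in> universe lim" for t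
  proof (rule lim_eqI)
    have tt: "is_term L t" "vars t \<subseteq> {..<n}"
      using t lim_trms by (auto simp: trms_def)
    show "eval lim ((!) lim_tuple) t \<in> universe lim"
      using tt lim_tuple_nth by (intro eval_in_univ[OF is_struc_lim]) auto
    have "\<forall>\<^sub>F k in sequentially. \<forall>i \<in> {..<n}. ev k (lim_tuple ! i) = c k ! i"
      using lim_tuple_nth by (intro eventually_ball_finite) auto
    moreover have "\<forall>\<^sub>F k in sequentially.
        ev k (eval lim ((!) lim_tuple) t) = eval M (\<lambda>i. ev k (lim_tuple ! i)) t"
      using tt lim_tuple_nth by (intro eval_lim) auto
    ultimately show "\<forall>\<^sub>F k in sequentially. ev k t = ev k (eval lim ((!) lim_tuple) t)"
    proof eventually_elim
      case (elim k)
      have "ev k t = eval M (\<lambda>i. ev k (lim_tuple ! i)) t"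
        using elim(1) tt by (intro eval_cong) auto
      with elim(2) show ?case by simp
    qed
  qed (rule t)
  moreover have "set lim_tuple \<subseteq> universe lim" "length lim_tuple = n"
    by (auto simp: lim_tuple_def trms_def lim_def)
  ultimately show ?thesis
    using lim_trms by (fastforce simp: gens_def generates_def trms_def)
qed

lemma sat_lim_tuple:
  assumes "\<phi> \<in> fmls L n"
  shows "sat lim ((!) lim_tuple) \<phi> \<longleftrightarrow> (\<forall>\<^sub>F k in sequentially. sat M ((!) (c k)) \<phi>)"
proof -
  \<comment> \<open>Past its length the list has no meaningful entries; a total assignment into the universe
      is needed.\<close>
  obtain t0 where t0: "t0 \<in> universe lim"
    using is_struc_lim by (auto simp: is_struc_def)
  define v where "v i = (if i < n then lim_tuple ! i else t0)" for i
  have "sat lim ((!) lim_tuple) \<phi> \<longleftrightarrow> sat lim v \<phi>"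
    using assms by (intro sat_cong) (auto simp: v_def fmls_def)
  also have "\<dots> \<longleftrightarrow> (\<forall>\<^sub>F k in sequentially. sat M (\<lambda>i. ev k (v i)) \<phi>)"
    using assms lim_tuple_nth(1) t0 by (intro sat_lim) (auto simp: v_def fmls_def)
  also have "\<dots> \<longleftrightarrow> (\<forall>\<^sub>F k in sequentially. sat M ((!) (c k)) \<phi>)"
  proof (rule eventually_cong)
    have "\<forall>\<^sub>F k in sequentially. \<forall>i \<in> {..<n}. ev k (lim_tuple ! i) = c k ! i"
      using lim_tuple_nth by (intro eventually_ball_finite) auto
    then show "\<forall>\<^sub>F k in sequentially. \<forall>i \<in> {..<n}. ev k (v i) = c k ! i"
      by eventually_elim (auto simp: v_def)
  next
    fix k assume "\<forall>i \<in> {..<n}. ev k (v i) = c k ! i"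
    then show "sat M (\<lambda>i. ev k (v i)) \<phi> \<longleftrightarrow> sat M ((!) (c k)) \<phi>"
      using assms by (intro sat_cong) (auto simp: fmls_def)
  qed
  finally show ?thesis .
qed

lemma is_model_lim:
  assumes "is_theory L T" "is_model L T M"
  shows "is_model L T lim"
  unfolding is_model_def
proof (intro conjI ballI allI impI)
  fix p and v :: "nat \<Rightarrow> 'f trm" assume p: "p \<in> T" and v: "range v \<subseteq> universe lim"
  have "ev k (v i) \<in> universe M" for i k
    using v lim_trms by (intro gens_eval_in[OF struc gens]) auto
  then have "range (\<lambda>i. ev k (v i)) \<subseteq> universe M" for k
    by auto
  then have "sat M (\<lambda>i. ev k (v i)) p" for k
    using assms(2) p by (simp add: is_model_def)
  moreover have "is_formula L p"
    using assms(1) p by (simp add: is_theory_def)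
  ultimately show "sat lim v p"
    using sat_lim[OF _ v] by simp
qed (rule is_struc_lim)

end


section \<open>An isolated generating tuple\<close>

text \<open>The Baire category argument in the form of a generic sequence. The members of \<open>B\<close> play the
  role of nonempty basic open sets, and each \<open>d \<in> D\<close> is a requirement that can be met by shrinking
  any of them. Meeting the requirements one after the other and then choosing points gives a sequence
  that eventually stays inside a set meeting any given requirement.\<close>

lemma generic_sequence:
  fixes B :: "'x set set"
  assumes D: "countable D" and B: "B \<noteq> {}" "{} \<notin> B"
    and dense: "\<And>d U. d \<in> D \<Longrightarrow> U \<in> B \<Longrightarrow> \<exists>V \<in> B. V \<subseteq> U \<and> V \<in> d"
  shows "\<exists>c. (\<forall>k. c k \<in> \<Union>B) \<and> (\<forall>d \<in> D. \<exists>V \<in> d. \<forall>\<^sub>F k in sequentially. c k \<in> V)"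
proof -
  obtain e :: "nat \<Rightarrow> 'x set set" where e: "D \<subseteq> range e"
    using D by (metis UNIV_I from_nat_into_surj image_eqI subsetI)
  obtain U0 where U0: "U0 \<in> B"
    using B by auto
  have "\<exists>U. \<forall>k. U k \<in> B \<and> (U (Suc k) \<subseteq> U k \<and> (e k \<in> D \<longrightarrow> U (Suc k) \<in> e k))"
  proof (rule dependent_nat_choice)
    show "\<exists>U. U \<in> B"
      using U0 by auto
    fix U k assume "U \<in> B"
    then show "\<exists>V. V \<in> B \<and> V \<subseteq> U \<and> (e k \<in> D \<longrightarrow> V \<in> e k)"
      using dense[of "e k" U] by blast
  qed
  then obtain U where U: "\<And>k. U k \<in> B" "\<And>k. U (Suc k) \<subseteq> U k" "\<And>k. e k \<in> D \<Longrightarrow> U (Suc k) \<in> e k"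
    by blast
  have "\<forall>k. \<exists>x. x \<in> U k"
    using U(1) B(2) by (metis ex_in_conv)
  then obtain c where c: "\<And>k. c k \<in> U k"
    by metis
  have anti: "U m \<subseteq> U k" if "k \<le> m" for k m
    using lift_Suc_antimono_le[of U, OF U(2) that] .
  show ?thesis
  proof (intro exI[of _ c] conjI allI ballI)
    show "c k \<in> \<Union>B" for k
      using c U(1) by blast
    fix d assume d: "d \<in> D"
    then obtain k where "d = e k"
      using e by auto
    then have "U (Suc k) \<in> d"
      using U(3) d by auto
    moreover have "\<forall>\<^sub>F m in sequentially. c m \<in> U (Suc k)"
      using anti c unfolding eventually_sequentially by blast
    ultimately show "\<exists>V \<in> d. \<forall>\<^sub>F k in sequentially. c k \<in> V"
      by auto
  qed
qed

lemma countable_representatives: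
  fixes L :: "('f, 'r) lang"
  assumes "countable (iso_classes L n T)"
  shows "\<exists>R :: (nat, 'f, 'r) struc set. countable R \<and>
    (\<forall>N \<in> n_gen_models L n T. \<exists>N' \<in> R. isomorphic L N N')"
proof -
  let ?r = "{(M, N). M \<in> n_gen_models L n T \<and> N \<in> n_gen_models L n T \<and> isomorphic L M N}"
  let ?R = "(\<lambda>C. SOME N. N \<in> C) ` iso_classes L n T"
  have "\<exists>N' \<in> ?R. isomorphic L N N'" if N: "N \<in> n_gen_models L n T" for N
  proof -
    have "is_iso L N N id"
      by (auto simp: is_iso_def)
    then have "N \<in> ?r `` {N}"
      using N by (auto simp: isomorphic_def)
    then have "(SOME N'. N' \<in> ?r `` {N}) \<in> ?r `` {N}"
      by (rule someI)
    moreover have "?r `` {N} \<in> iso_classes L n T"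
      using N unfolding iso_classes_def by (rule quotientI)
    ultimately show ?thesis
      by blast
  qed
  moreover have "countable ?R"
    using assms by simp
  ultimately show ?thesis
    by blast
qed

text \<open>Without an isolated tuple, each nonempty definable set of generating tuples contains two
  tuples of different types, so it can be shrunk to avoid any one given type. This is the only place
  where the assumption for contradiction enters; it makes \<open>avoid\<close> a legitimate requirement.\<close>

lemma isolated_generating_tuple:
  assumes L: "countable_lang L" and T: "is_theory L T" and few: "countable (iso_classes L n T)"
    and M: "is_model L T M" "n_generated L n M"
  shows "\<exists>\<phi> \<in> fmls L n. \<exists>c \<in> gens L M n. sat M ((!) c) \<phi> \<and>
    (\<forall>d \<in> gens L M n. sat M ((!) d) \<phi> \<longrightarrow> aut_equiv L M c d)"
proof (rule ccontr)
  assume not_isolated: "\<not> ?thesis"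
  have struc: "is_struc L M"
    using M by (simp add: is_model_def)
  obtain R :: "(nat, 'a, 'b) struc set" where R: "countable R"
      "\<And>N. N \<in> n_gen_models L n T \<Longrightarrow> \<exists>N' \<in> R. isomorphic L N N'"
    using countable_representatives[OF few] by blast
  define ext where "ext \<phi> = {c \<in> gens L M n. sat M ((!) c) \<phi>}" for \<phi>
  define B where "B = ext ` fmls L n - {{}}"
  define decide where "decide \<phi> = {V. V \<subseteq> ext \<phi> \<or> V \<inter> ext \<phi> = {}}" for \<phi>
  define witness where "witness = (\<lambda>(j, q). {V. V \<inter> ext (Ex j q) = {} \<or>
    (\<exists>t \<in> trms L n. \<forall>c \<in> V. sat M (((!) c)(j := eval M ((!) c) t)) q)})"
  define avoid where
    "avoid = (\<lambda>(N :: (nat, 'a, 'b) struc, d). {V. \<exists>\<phi> \<in> fmls L n. V \<subseteq> ext \<phi> \<and> \<not> sat N ((!) d) \<phi>})"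
  let ?E = "{(j, q). Ex j q \<in> fmls L n}"
  let ?D = "decide ` fmls L n \<union> witness ` ?E \<union> avoid ` (R \<times> UNIV)"

  have cF: "countable (fmls L n)"
    by (rule countable_subset[OF _ countable_formulas[OF L]]) (auto simp: fmls_def)
  have "?E \<subseteq> UNIV \<times> {q. is_formula L q}"
    by (auto simp: fmls_def)
  then have "countable ?E"
    by (rule countable_subset) (intro countable_SIGMA countable_formulas[OF L] countableI_type)
  then have "countable ?D"
    using cF R(1) by simp
  moreover have "B \<noteq> {}"
  proof -
    \<comment> \<open>The set of all generating tuples is definable, by a trivial equation \<open>t = t\<close>; a term \<open>t\<close>
        exists because the universe is nonempty and generated.\<close>
    obtain c where c: "c \<in> gens L M n"
      using M(2) by (auto simp: n_generated_def gens_def)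
    obtain x where "x \<in> universe M"
      using struc by (auto simp: is_struc_def)
    then obtain t where "t \<in> trms L n"
      using gens_term[OF c] by metis
    then have "Eq t t \<in> fmls L n"
      by (auto simp: fmls_def trms_def)
    moreover have "c \<in> ext (Eq t t)"
      using c by (simp add: ext_def)
    ultimately show ?thesis
      by (auto simp: B_def)
  qed
  moreover have "{} \<notin> B"
    by (simp add: B_def)
  moreover have "\<exists>V \<in> B. V \<subseteq> U \<and> V \<in> d" if d: "d \<in> ?D" and U: "U \<in> B" for d U
  proof -
    obtain \<psi> where \<psi>: "\<psi> \<in> fmls L n" "U = ext \<psi>"
      using U by (auto simp: B_def)
    obtain c where c: "c \<in> U"
      using U by (auto simp: B_def)
    then have cg: "c \<in> gens L M n"
      by (simp add: \<psi> ext_def)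
    have refine: "U \<inter> ext \<chi> \<in> B" if "\<chi> \<in> fmls L n" "b \<in> U \<inter> ext \<chi>" for b \<chi>
    proof -
      have "U \<inter> ext \<chi> = ext (Conj \<psi> \<chi>)" "Conj \<psi> \<chi> \<in> fmls L n"
        using \<psi> that(1) by (auto simp: ext_def fmls_def)
      then show ?thesis
        using that(2) by (auto simp: B_def)
    qed
    have neg: "Neg \<chi> \<in> fmls L n" "ext (Neg \<chi>) \<inter> ext \<chi> = {}" if "\<chi> \<in> fmls L n" for \<chi>
      using that by (auto simp: fmls_def ext_def)
    from d consider (decide) \<chi> where "\<chi> \<in> fmls L n" "d = decide \<chi>"
      | (witness) j q where "Ex j q \<in> fmls L n" "d = witness (j, q)"
      | (avoid) N a where "d = avoid (N, a)"
      by auto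
    then show ?thesis
    proof cases
      case (decide \<chi>)
      show ?thesis
      proof (cases "c \<in> ext \<chi>")
        case True
        then have "U \<inter> ext \<chi> \<in> B"
          using refine decide c by blast
        then show ?thesis
          by (intro bexI[of _ "U \<inter> ext \<chi>"]) (auto simp: decide decide_def)
      next
        case False
        then have "c \<in> ext (Neg \<chi>)"
          using cg by (simp add: ext_def)
        then have "U \<inter> ext (Neg \<chi>) \<in> B"
          using refine neg decide c by blast
        then show ?thesis
          using neg(2) decide(1) by (intro bexI[of _ "U \<inter> ext (Neg \<chi>)"]) (auto simp: decide(2) decide_def)
      qed
    next
      case (witness j q)
      show ?thesis
      proof (cases "c \<in> ext (Ex j q)")
        case True
        then obtain x where x: "x \<in> universe M" "sat M (((!) c)(j := x)) q"
          by (auto simp: ext_def)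
        then obtain t where t: "t \<in> trms L n" "x = eval M ((!) c) t"
          using gens_term[OF cg] by metis
        let ?\<chi> = "subst (Var(j := t)) q"
        have s: "sat M ((!) b) ?\<chi> \<longleftrightarrow> sat M (((!) b)(j := eval M ((!) b) t)) q" for b
          unfolding sat_subst by (intro sat_cong) auto
        have \<chi>: "?\<chi> \<in> fmls L n"
          using witness(1) t(1) by (intro subst_in_fmls) (auto simp: fmls_def trms_def)
        have "c \<in> ext ?\<chi>"
          using x(2) s cg t(2) by (simp add: ext_def)
        then have "U \<inter> ext ?\<chi> \<in> B"
          using refine \<chi> c by blast
        then show ?thesis
          using s t(1) by (intro bexI[of _ "U \<inter> ext ?\<chi>"]) (auto simp: witness(2) witness_def ext_def)
      next
        case False
        then have "c \<in> ext (Neg (Ex j q))"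
          using cg by (simp add: ext_def)
        then have "U \<inter> ext (Neg (Ex j q)) \<in> B"
          using refine neg witness(1) c by blast
        then show ?thesis
          using neg(2)[OF witness(1)]
          by (intro bexI[of _ "U \<inter> ext (Neg (Ex j q))"]) (auto simp: witness(2) witness_def)
      qed
    next
      case (avoid N a)
      obtain c' where c': "c' \<in> gens L M n" "c' \<in> U" "\<not> aut_equiv L M c c'"
        using not_isolated \<psi> c cg unfolding ext_def by blast
      then obtain \<chi> where \<chi>: "\<chi> \<in> fmls L n" "sat M ((!) c) \<chi> \<longleftrightarrow> \<not> sat M ((!) c') \<chi>"
        using same_type_aut_equiv[OF struc cg c'(1)] by blast
      \<comment> \<open>A formula separating two members of \<open>U\<close> or its negation fails at the tuple to be avoided,
          and each of the two holds at one of the members.\<close>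
      have "\<exists>\<theta> \<in> fmls L n. \<not> sat N ((!) a) \<theta> \<and> (c \<in> ext \<theta> \<or> c' \<in> ext \<theta>)"
      proof (cases "sat N ((!) a) \<chi>")
        case True
        then show ?thesis
          using \<chi> neg(1)[OF \<chi>(1)] cg c' by (intro bexI[of _ "Neg \<chi>"]) (auto simp: ext_def)
      next
        case False
        then show ?thesis
          using \<chi> cg c' by (intro bexI[of _ "\<chi>"]) (auto simp: ext_def)
      qed
      then obtain \<theta> b where \<theta>: "\<theta> \<in> fmls L n" "\<not> sat N ((!) a) \<theta>" "b \<in> U \<inter> ext \<theta>"
        using c c' by blast
      then show ?thesis
        using refine[of \<theta> b]
        by (intro bexI[of _ "U \<inter> ext \<theta>"]) (auto simp: avoid avoid_def)
    qed
  qed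
  ultimately have "\<exists>c. (\<forall>k. c k \<in> \<Union>B) \<and> (\<forall>d \<in> ?D. \<exists>V \<in> d. \<forall>\<^sub>F k in sequentially. c k \<in> V)"
    by (rule generic_sequence)
  then obtain c where c: "\<And>k. c k \<in> \<Union>B"
      "\<And>d. d \<in> ?D \<Longrightarrow> \<exists>V \<in> d. \<forall>\<^sub>F k in sequentially. c k \<in> V"
    by (elim exE conjE) blast
  have cg: "c k \<in> gens L M n" for k
    using c(1)[of k] by (auto simp: B_def ext_def)

  \<comment> \<open>The locale quantifies over assignments of terms; substitution turns each instance into a single
      formula in the \<open>n\<close> variables, for which there is a requirement.\<close>
  interpret complete_sequence L M n c
  proof
    show "is_struc L M" "c k \<in> gens L M n" for k
      by (fact struc cg)+
  next
    fix p and s :: "nat \<Rightarrow> 'a trm" assume p: "is_formula L p" and s: "range s \<subseteq> trms L n"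
    have "subst s p \<in> fmls L n"
      using p s by (intro subst_in_fmls) auto
    then obtain V where "V \<subseteq> ext (subst s p) \<or> V \<inter> ext (subst s p) = {}"
        and cV: "\<forall>\<^sub>F k in sequentially. c k \<in> V"
      using c(2)[of "decide (subst s p)"] by (auto simp: decide_def)
    then show "(\<forall>\<^sub>F k in sequentially. sat M (\<lambda>i. eval M ((!) (c k)) (s i)) p) \<or>
      (\<forall>\<^sub>F k in sequentially. \<not> sat M (\<lambda>i. eval M ((!) (c k)) (s i)) p)"
    proof (elim disjE)
      assume V: "V \<subseteq> ext (subst s p)"
      show ?thesis
        by (rule disjI1, rule eventually_mono[OF cV]) (use V in \<open>auto simp: ext_def sat_subst\<close>)
    next
      assume V: "V \<inter> ext (subst s p) = {}"
      show ?thesis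
        by (rule disjI2, rule eventually_mono[OF cV]) (use V cg in \<open>auto simp: ext_def sat_subst\<close>)
    qed
  next
    fix p i and s :: "nat \<Rightarrow> 'a trm" assume p: "is_formula L p" and s: "range s \<subseteq> trms L n"
      and ex: "\<forall>\<^sub>F k in sequentially. sat M (\<lambda>i. eval M ((!) (c k)) (s i)) (Ex i p)"
    obtain j q where jq: "subst s (Ex i p) = Ex j q"
        "\<forall>v x. sat M (v(j := x)) q \<longleftrightarrow> sat M ((\<lambda>m. eval M v (s m))(i := x)) p"
      using subst_Ex[of s i p M] by (elim exE conjE) (rule that)
    have "Ex j q \<in> fmls L n"
      unfolding jq(1)[symmetric] using p s by (intro subst_in_fmls) auto
    then have "witness (j, q) \<in> ?D"
      by blast
    then obtain V where V: "V \<inter> ext (Ex j q) = {} \<or>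
        (\<exists>t \<in> trms L n. \<forall>c \<in> V. sat M (((!) c)(j := eval M ((!) c) t)) q)"
        and cV: "\<forall>\<^sub>F k in sequentially. c k \<in> V"
      using c(2)[of "witness (j, q)"] by (auto simp: witness_def)
    have "\<forall>\<^sub>F k in sequentially. c k \<in> V \<inter> ext (Ex j q)"
      using ex cV
    proof eventually_elim
      case (elim k)
      then show ?case
        using cg[of k] sat_subst[of M "(!) (c k)" s "Ex i p"] unfolding jq(1) by (simp add: ext_def)
    qed
    then have "V \<inter> ext (Ex j q) \<noteq> {}"
      using eventually_happens[of _ sequentially] by fastforce
    then obtain t where t: "t \<in> trms L n" "\<forall>c \<in> V. sat M (((!) c)(j := eval M ((!) c) t)) q"
      using V by blast
    then show "\<exists>t \<in> trms L n. \<forall>\<^sub>F k in sequentially.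
        sat M ((\<lambda>i. eval M ((!) (c k)) (s i))(i := eval M ((!) (c k)) t)) p"
      using cV by (auto simp: jq(2)[rule_format] elim!: eventually_mono)
  qed

  \<comment> \<open>The limit is an \<open>n\<close>-generated model, so it is isomorphic to a member of \<open>R\<close>; the image of its
      generators there has the limit type, which was to be avoided.\<close>
  have "n_generated L n lim"
    using lim_tuple_gens by (auto simp: gens_def n_generated_def)
  from n_gen_model_nat[OF L T is_model_lim[OF T M(1)] this]
  obtain N g where N: "N \<in> n_gen_models L n T" "is_iso L lim N g"
    unfolding isomorphic_def by blast
  from R(2)[OF N(1)] obtain N' h where N': "N' \<in> R" "is_iso L N N' h"
    unfolding isomorphic_def by blast
  let ?d = "map h (map g lim_tuple)"
  have "avoid (N', ?d) \<in> ?D"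
    using N'(1) by blast
  then obtain V \<phi> where \<phi>: "\<phi> \<in> fmls L n" "V \<subseteq> ext \<phi>" "\<not> sat N' ((!) ?d) \<phi>"
      and cV: "\<forall>\<^sub>F k in sequentially. c k \<in> V"
    using c(2)[of "avoid (N', ?d)"] by (auto simp: avoid_def)
  have len: "length lim_tuple = n"
    by (simp add: lim_tuple_def)
  have gU: "g ` universe lim = universe N"
    using N(2) by (simp add: is_iso_def bij_betw_def)
  have "\<forall>\<^sub>F k in sequentially. sat M ((!) (c k)) \<phi>"
    using cV \<phi>(2) by (auto simp: ext_def elim!: eventually_mono)
  then have "sat lim ((!) lim_tuple) \<phi>"
    using sat_lim_tuple \<phi>(1) by simp
  also have "sat lim ((!) lim_tuple) \<phi> \<longleftrightarrow> sat N ((!) (map g lim_tuple)) \<phi>"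
    using \<phi>(1) lim_tuple_nth(1) len
    by (intro iso_sat[OF is_struc_lim N(2), symmetric]) (auto simp: fmls_def)
  also have "\<dots> \<longleftrightarrow> sat N' ((!) ?d) \<phi>"
    using \<phi>(1) lim_tuple_nth(1) len N(1) gU
    by (intro iso_sat[OF _ N'(2), symmetric]) (auto simp: fmls_def n_gen_models_def is_model_def subset_eq)
  finally show False
    using \<phi>(3) by simp
qed


section \<open>From one generating tuple to all\<close>

lemma sat_foldr_Conj: "sat M v (foldr Conj ps q) \<longleftrightarrow> (\<forall>p \<in> set ps. sat M v p) \<and> sat M v q"
  by (induction ps) auto

lemma foldr_Conj_in_fmls: "set ps \<subseteq> fmls L n \<Longrightarrow> q \<in> fmls L n \<Longrightarrow> foldr Conj ps q \<in> fmls L n"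
  by (induction ps) (auto simp: fmls_def)

text \<open>Substituting \<open>\<sigma>\<close> turns a term evaluated at \<open>a\<close> into one evaluated at \<open>b\<close>; the terms \<open>\<tau>\<close> only
  ensure that \<open>b\<close> lies in the universe.\<close>

lemma gens_translate:
  assumes M: "is_struc L M" and a: "a \<in> gens L M m" and len: "length b = n"
    and \<tau>: "\<And>i. i < n \<Longrightarrow> \<tau> i \<in> trms L m" "\<And>i. i < n \<Longrightarrow> b ! i = eval M ((!) a) (\<tau> i)"
    and \<sigma>: "\<And>i. i < m \<Longrightarrow> \<sigma> i \<in> trms L n" "\<And>i. i < m \<Longrightarrow> a ! i = eval M ((!) b) (\<sigma> i)"
  shows "b \<in> gens L M n"
proof -
  have "set b \<subseteq> universe M"
    using \<tau> len gens_eval_in[OF M a] by (auto simp: set_conv_nth)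
  moreover have "\<exists>t \<in> trms L n. x = eval M ((!) b) t" if x: "x \<in> universe M" for x
  proof -
    obtain t where t: "t \<in> trms L m" "x = eval M ((!) a) t"
      using gens_term[OF a x] by metis
    have "eval M ((!) a) t = eval M ((!) b) (subst_trm \<sigma> t)"
      unfolding eval_subst using t(1) \<sigma>(2) by (intro eval_cong) (auto simp: trms_def)
    moreover have "subst_trm \<sigma> t \<in> trms L n"
      using t(1) \<sigma>(1) by (intro subst_trm_in_trms) (auto simp: trms_def)
    ultimately show ?thesis
      using t(2) by auto
  qed
  ultimately show ?thesis
    using len by (fastforce simp: gens_def generates_def trms_def)
qed

text \<open>With \<open>c = \<tau>(a)\<close> and \<open>a = \<sigma>(c)\<close>, the formula for \<open>a\<close> is \<open>\<phi>(\<tau>(x)) \<and> x = \<sigma>(\<tau>(x))\<close>. If \<open>b\<close>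
  satisfies it, then \<open>\<tau>(b)\<close> generates because \<open>b\<close> is obtained from it by terms, so an automorphism
  takes \<open>c\<close> to \<open>\<tau>(b)\<close>, and it takes \<open>a = \<sigma>(c)\<close> to \<open>\<sigma>(\<tau>(b)) = b\<close>.\<close>

lemma isolated_transfer:
  assumes M: "is_struc L M" and \<phi>: "\<phi> \<in> fmls L n" and c: "c \<in> gens L M n" "sat M ((!) c) \<phi>"
    and iso: "\<And>d. d \<in> gens L M n \<Longrightarrow> sat M ((!) d) \<phi> \<Longrightarrow> aut_equiv L M c d"
    and a: "a \<in> gens L M m"
  shows "\<exists>\<psi> \<in> fmls L m. \<forall>b \<in> gens L M m. aut_equiv L M a b \<longleftrightarrow> sat M ((!) b) \<psi>"
proof -
  have "\<forall>i. \<exists>t. i < n \<longrightarrow> t \<in> trms L m \<and> c ! i = eval M ((!) a) t"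
    using gens_nth[OF c(1)] gens_term[OF a] by metis
  then obtain \<tau> where \<tau>: "\<And>i. i < n \<Longrightarrow> \<tau> i \<in> trms L m" "\<And>i. i < n \<Longrightarrow> c ! i = eval M ((!) a) (\<tau> i)"
    by metis
  have "\<forall>i. \<exists>t. i < m \<longrightarrow> t \<in> trms L n \<and> a ! i = eval M ((!) c) t"
    using gens_nth[OF a] gens_term[OF c(1)] by metis
  then obtain \<sigma> where \<sigma>: "\<And>i. i < m \<Longrightarrow> \<sigma> i \<in> trms L n" "\<And>i. i < m \<Longrightarrow> a ! i = eval M ((!) c) (\<sigma> i)"
    by metis
  define \<psi> where "\<psi> = foldr Conj (map (\<lambda>i. Eq (Var i) (subst_trm \<tau> (\<sigma> i))) [0..<m]) (subst \<tau> \<phi>)"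
  define tup where "tup b = map (\<lambda>i. eval M ((!) b) (\<tau> i)) [0..<n]" for b
  have "subst_trm \<tau> (\<sigma> i) \<in> trms L m" if "i < m" for i
    using \<sigma>(1)[OF that] \<tau>(1) by (intro subst_trm_in_trms) (auto simp: trms_def)
  moreover have "subst \<tau> \<phi> \<in> fmls L m"
    using \<phi> \<tau>(1) by (intro subst_in_fmls) (auto simp: fmls_def)
  ultimately have \<psi>: "\<psi> \<in> fmls L m"
    unfolding \<psi>_def by (intro foldr_Conj_in_fmls) (fastforce simp: fmls_def trms_def)+
  have "eval M (\<lambda>j. eval M ((!) b) (\<tau> j)) (\<sigma> i) = eval M ((!) (tup b)) (\<sigma> i)" if "i < m" for b i
    using \<sigma>(1)[OF that] by (intro eval_cong) (auto simp: trms_def tup_def)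
  moreover have "sat M (\<lambda>j. eval M ((!) b) (\<tau> j)) \<phi> \<longleftrightarrow> sat M ((!) (tup b)) \<phi>" for b
    using \<phi> by (intro sat_cong) (auto simp: fmls_def tup_def)
  ultimately have sat_\<psi>: "sat M ((!) b) \<psi> \<longleftrightarrow>
      (\<forall>i < m. b ! i = eval M ((!) (tup b)) (\<sigma> i)) \<and> sat M ((!) (tup b)) \<phi>" for b
    by (auto simp: \<psi>_def sat_foldr_Conj eval_subst sat_subst)
  have "aut_equiv L M a b \<longleftrightarrow> sat M ((!) b) \<psi>" if b: "b \<in> gens L M m" for b
  proof
    assume "aut_equiv L M a b"
    then obtain h where h: "is_iso L M M h" "map h a = b"
      by (auto simp: aut_equiv_def)
    have "tup a = c"
      using c(1) \<tau>(2) by (intro nth_equalityI) (auto simp: tup_def gens_def)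
    then have "sat M ((!) a) \<psi>"
      using sat_\<psi> c(2) \<sigma>(2) by simp
    moreover have "sat M ((!) b) \<psi> \<longleftrightarrow> sat M ((!) a) \<psi>"
      using \<psi> a gens_nth[OF a] h(2) by (intro iso_sat[OF M h(1)]) (auto simp: fmls_def gens_def)
    ultimately show "sat M ((!) b) \<psi>"
      by simp
  next
    assume "sat M ((!) b) \<psi>"
    then have *: "\<And>i. i < m \<Longrightarrow> b ! i = eval M ((!) (tup b)) (\<sigma> i)" "sat M ((!) (tup b)) \<phi>"
      using sat_\<psi> by auto
    have "tup b \<in> gens L M n"
      by (rule gens_translate[OF M b _ \<tau>(1) _ \<sigma>(1) *(1)]) (auto simp: tup_def)
    then obtain h where h: "is_iso L M M h" "map h c = tup b"
      using iso *(2) by (auto simp: aut_equiv_def)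
    have "map h a = b"
    proof (rule nth_equalityI)
      show "length (map h a) = length b"
        using a b by (simp add: gens_def)
      fix i assume "i < length (map h a)"
      then have i: "i < m" "i < length a"
        using a by (auto simp: gens_def)
      have "h (a ! i) = h (eval M ((!) c) (\<sigma> i))"
        using \<sigma>(2) i by simp
      also have "\<dots> = eval M ((!) (tup b)) (\<sigma> i)"
        using \<sigma>(1)[OF i(1)] gens_nth[OF c(1)] c(1)
        by (intro iso_eval[OF M h(1), symmetric]) (auto simp: trms_def gens_def h(2)[symmetric])
      finally show "map h a ! i = b ! i"
        using *(1) i by simp
    qed
    then show "aut_equiv L M a b"
      using h(1) by (auto simp: aut_equiv_def)
  qed
  with \<psi> show ?thesis
    by blast
qed

theorem theorem4p3:
  fixes L :: "('f, 'r) lang" and T :: "('f, 'r) form set" and n :: nat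
    and M :: "('a, 'f, 'r) struc"
  assumes "countable_lang L"
    and "n \<ge> 1"
    and "is_theory L T"
    and "n_consistent L n T"
    and "countable (iso_classes L n T)"
    and "is_model L T M"
    and "n_generated L n M"
  shows "\<forall>a. generates L M a \<longrightarrow>
    (\<exists>\<phi>. is_formula L \<phi> \<and> free_vars \<phi> \<subseteq> {..<length a} \<and>
      (\<forall>b. generates L M b \<and> length b = length a \<longrightarrow>
        (aut_equiv L M a b \<longleftrightarrow> sat M ((!) b) \<phi>)))"
proof (intro allI impI)
  fix a assume a: "generates L M a"
  have M: "is_struc L M"
    using assms(6) by (simp add: is_model_def)
  obtain \<phi> c where \<phi>: "\<phi> \<in> fmls L n" "c \<in> gens L M n" "sat M ((!) c) \<phi>"
      "\<And>d. d \<in> gens L M n \<Longrightarrow> sat M ((!) d) \<phi> \<Longrightarrow> aut_equiv L M c d"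
    using isolated_generating_tuple[OF assms(1,3,5,6,7)] by blast
  have "a \<in> gens L M (length a)"
    using a by (simp add: gens_def)
  from isolated_transfer[OF M \<phi> this]
  show "\<exists>\<phi>. is_formula L \<phi> \<and> free_vars \<phi> \<subseteq> {..<length a} \<and>
      (\<forall>b. generates L M b \<and> length b = length a \<longrightarrow>
        (aut_equiv L M a b \<longleftrightarrow> sat M ((!) b) \<phi>))"
    unfolding fmls_def gens_def by blast
qed

end
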